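(* Let $n\ge 1$, $\epsilon\ge 0$ and $\beta\ge 0$ be reals, and let $A,B\subseteq\{0,1\}^n$ form a Uniquely Decodable Code Pair with $|A|\ge 2^{(1-\epsilon)n}$ and $|B|=2^{\beta n}$. Then $\beta\le 0.4228+\sqrt{\epsilon}$.
   Context: Two sets $A,B\subseteq\{0,1\}^n$ form a Uniquely Decodable Code Pair (UDCP) if every pair $(a,b)\in A\times B$ yields a distinct sum $a+b$, where addition is over $\mathbb{Z}^n$; equivalently $|A+B|=|A|\cdot|B|$ with $A+B=\{a+b: a\in A, b\in B\}$. *)

theory Defs
  imports Complex_Main
begin

definition binvecs :: "nat \<Rightarrow> int list set" where
  "binvecs n = {v. length v = n \<and> set v \<subseteq> {0, 1}}"

definition sumset :: "int list set \<Rightarrow> int list set \<Rightarrow> int list set" where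
  "sumset A B = {map2 (+) a b | a b. a \<in> A \<and> b \<in> B}"

definition udcp :: "nat \<Rightarrow> int list set \<Rightarrow> int list set \<Rightarrow> bool" where
  "udcp n A B \<longleftrightarrow> A \<subseteq> binvecs n \<and> B \<subseteq> binvecs n \<and>
     card (sumset A B) = card A * card B"

end

theory Submission
  imports Defs "HOL-Probability.Hoeffding"
begin

text \<open>
  Fix the most popular set \<open>D\<close> of coordinates on which members of \<open>A\<close> and \<open>B\<close> differ, and let \<open>B'\<close>
  consist of the \<open>b \<in> B\<close> that have a partner \<open>a \<in> A\<close> differing from \<open>b\<close> exactly on \<open>D\<close>. By averaging
  \<open>|B'| \<ge> |A| |B| / 2^n\<close>, and unique decodability makes the projections of \<open>B'\<close> to \<open>D\<close> and to its
  complement injective. Let \<open>T\<close> be the smaller of the two sets, so \<open>|T| \<le> n/2\<close>.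

  Weigh a pair \<open>(a, b) \<in> A \<times> B'\<close> by \<open>1/7\<close> for each differing coordinate in \<open>T\<close> and by \<open>1/2\<close> for each
  other differing coordinate. Differences \<open>a - b\<close> are distinct, so the total weight is at most
  \<open>(9/7)^|T| 2^(n-|T|)\<close>. A reverse hypercontractive two-point inequality tensorizes to a lower bound
  \<open>c^|T| d^(n-|T|) |B'|^2 (|A|/2^n)^(1/r)\<close>, where \<open>c \<rightarrow> 3/(2 sqrt 7)\<close> and \<open>d \<rightarrow> sqrt 2\<close> as \<open>r \<rightarrow> 0\<close>.
  In this limit \<open>\<epsilon> = 0\<close> gives \<open>\<beta> \<le> log2 (72/7) / 8 < 0.4205\<close>; in general the loss is balanced by
  taking \<open>r\<close> of order \<open>sqrt \<epsilon>\<close>.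
\<close>

section \<open>Two-point inequalities\<close>

text \<open>Subgaussianity of a fair sign: the auxiliary estimate behind Hoeffding's lemma at
  probability \<open>1/2\<close>, with evenness of \<open>cosh\<close> for negative
  arguments.\<close>

lemma cosh_le_exp_half_square: "cosh x \<le> exp (x\<^sup>2 / 2)" for x :: real
proof -
  have "ln (cosh \<bar>x\<bar>) \<le> \<bar>x\<bar>\<^sup>2 / 2"
  proof -
    have "1 + (1/2) * (exp (2 * \<bar>x\<bar>) - 1) = exp \<bar>x\<bar> * cosh \<bar>x\<bar>"
      by (simp add: cosh_def field_simps flip: exp_add)
    then have "- (2 * \<bar>x\<bar>) * (1/2) + (\<bar>x\<bar> + ln (cosh \<bar>x\<bar>)) \<le> (2 * \<bar>x\<bar>)\<^sup>2 / 8"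
      using Hoeffdings_lemma_aux[of "2 * \<bar>x\<bar>" "1/2"] by (simp add: ln_mult cosh_real_pos)
    then show ?thesis by (simp add: power_mult_distrib)
  qed
  then have "cosh \<bar>x\<bar> \<le> exp (\<bar>x\<bar>\<^sup>2 / 2)"
    by (metis cosh_real_pos exp_le_cancel_iff exp_ln)
  then show ?thesis by (cases "x \<ge> 0") auto
qed

text \<open>The \<open>L^r\<close> quasinorm for the uniform probability measure on two points. It
  is applied with \<open>0 < r < 1\<close>, where Hoelder's inequality reverses.\<close>

definition pmean :: "real \<Rightarrow> real \<Rightarrow> real \<Rightarrow> real" where
  "pmean r x y = ((x powr r + y powr r) / 2) powr (1 / r)"

lemma pmean_nonneg: "0 \<le> pmean r x y"
  by (simp add: pmean_def)

lemma pmean_commute: "pmean r x y = pmean r y x"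
  by (simp add: pmean_def add.commute)

lemma pmean_powr: "r > 0 \<Longrightarrow> pmean r x y powr r = (x powr r + y powr r) / 2"
  by (simp add: pmean_def powr_powr)

lemma powr_mult_le_weighted_mean:
  fixes u v r :: real
  assumes "0 < r" "r < 1" "0 \<le> u" "0 < v"
  shows "u powr r * v powr (1 - r) \<le> r * u + (1 - r) * v"
  using assms Youngs_inequality_0[of r "1 - r" u v] by (cases "u = 0") auto

text \<open>The reverse Hoelder inequality with exponents \<open>r\<close> and \<open>-\<rho>\<close>, where \<open>1/r - 1/\<rho> = 1\<close>,
  followed by a comparison of the \<open>(-\<rho>)\<close>-mean of \<open>P\<close> and \<open>Q\<close> with their geometric mean.\<close>

lemma pmean_le_weighted_sum:
  fixes P Q x y \<kappa> \<rho> :: real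
  assumes "P > 0" "Q > 0" "x \<ge> 0" "y \<ge> 0" and \<rho>: "\<rho> > 0"
    and r: "r = \<rho> / (1 + \<rho>)" and "P \<le> \<kappa> * Q" "Q \<le> \<kappa> * P"
  shows "2 * sqrt (P * Q) * exp (- \<rho> * (ln \<kappa>)\<^sup>2 / 8) * pmean r x y \<le> P * x + Q * y"
proof (cases "x = 0 \<and> y = 0")
  case True
  then show ?thesis by (simp add: pmean_def)
next
  case False
  have r01: "0 < r" "r < 1" using \<rho> by (auto simp: r field_simps)
  \<comment> \<open>The relation \<open>1/r - 1/\<rho> = 1\<close>, in the form that cancels the
    powers of \<open>P\<close> and \<open>Q\<close> below.\<close>
  have r\<rho>: "\<rho> * (1 - r) = r" using \<rho> by (simp add: r field_simps)
  define S where "S = P * x + Q * y"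
  define V where "V = P powr (-\<rho>) + Q powr (-\<rho>)"
  define l where "l = ln P - ln Q"
  have S: "S > 0" unfolding S_def using False assms
    by (metis add_nonneg_pos add_pos_nonneg less_eq_real_def mult_eq_0_iff mult_nonneg_nonneg mult_pos_pos)
  have V: "V > 0" unfolding V_def using assms by (simp add: add_pos_pos)
  have \<kappa>: "\<kappa> > 0" using assms by (metis less_le_trans mult_pos_pos zero_less_mult_pos2)
  have "ln P \<le> ln \<kappa> + ln Q" "ln Q \<le> ln \<kappa> + ln P"
    using assms \<kappa> by (metis ln_le_cancel_iff ln_mult_pos mult_pos_pos)+
  then have "\<bar>l\<bar> \<le> ln \<kappa>" by (auto simp: l_def)
  then have l2: "l\<^sup>2 \<le> (ln \<kappa>)\<^sup>2" by (simp add: abs_le_square_iff[symmetric])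
  \<comment> \<open>Weighted AM-GM for \<open>R * z\<close> and \<open>R powr (-\<rho>)\<close>.
    Division by \<open>S\<close> and \<open>V\<close> makes each kind of term add up to 1, so two
    instances sum to Hoelder's inequality.\<close>
  have part: "z powr r \<le> (r * (R * z / S) + (1 - r) * (R powr (-\<rho>) / V)) * (S powr r * V powr (1 - r))"
    if "R > 0" "z \<ge> 0" for R z
  proof -
    have "(R * z / S) powr r * (R powr (-\<rho>) / V) powr (1 - r)
        = z powr r * (R powr r * R powr (-\<rho> * (1 - r))) / (S powr r * V powr (1 - r))"
      using that S V by (simp add: powr_divide powr_mult powr_powr)
    also have "\<dots> = z powr r / (S powr r * V powr (1 - r))"
      using that r\<rho> by (simp flip: powr_add)
    finally show ?thesis
      using powr_mult_le_weighted_mean[of r "R * z / S" "R powr (-\<rho>) / V"] r01 S V that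
      by (simp add: pos_divide_le_eq)
  qed
  have "x powr r + y powr r \<le>
     (r * (P * x / S + Q * y / S) + (1 - r) * (P powr (-\<rho>) / V + Q powr (-\<rho>) / V)) * (S powr r * V powr (1 - r))"
    using add_mono[OF part[of P x] part[of Q y]] assms by (simp add: algebra_simps)
  also have "P * x / S + Q * y / S = 1" using S by (simp add: S_def flip: add_divide_distrib)
  also have "P powr (-\<rho>) / V + Q powr (-\<rho>) / V = 1" using V by (simp add: V_def flip: add_divide_distrib)
  finally have le1: "x powr r + y powr r \<le> S powr r * V powr (1 - r)" by simp
  \<comment> \<open>Centred at the geometric mean of \<open>P\<close> and \<open>Q\<close>,
    \<open>V\<close> exceeds its main term only by a \<open>cosh\<close>, of second order in
    \<open>\<rho>\<close>; after the final root the loss is linear in \<open>\<rho>\<close>.\<close>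
  have "V = 2 * (exp (-\<rho> * (ln P + ln Q) / 2) * cosh (\<rho> * l / 2))"
    using assms by (simp add: V_def powr_def cosh_def l_def field_simps flip: exp_add)
  also have "\<dots> \<le> 2 * (exp (-\<rho> * (ln P + ln Q) / 2) * exp ((\<rho> * l / 2)\<^sup>2 / 2))"
    using cosh_le_exp_half_square[of "\<rho> * l / 2"] by simp
  also have "\<dots> \<le> 2 * (exp (-\<rho> * (ln P + ln Q) / 2) * exp (\<rho>\<^sup>2 * (ln \<kappa>)\<^sup>2 / 8))"
    using l2 by (simp add: power_mult_distrib power_divide mult_left_mono)
  finally have "ln V \<le> ln 2 + (-\<rho> * (ln P + ln Q) / 2 + \<rho>\<^sup>2 * (ln \<kappa>)\<^sup>2 / 8)"
    using V by (simp add: ln_ge_iff[symmetric] exp_add flip: exp_add ln_le_cancel_iff) (simp add: ln_mult)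
  then have "(1 - r) * ln V \<le> (1 - r) * (ln 2 + (-\<rho> * (ln P + ln Q) / 2 + \<rho>\<^sup>2 * (ln \<kappa>)\<^sup>2 / 8))"
    using r01 by simp
  also have "\<dots> = (1 - r) * ln 2 + \<rho> * (1 - r) * (- (ln P + ln Q) / 2 + \<rho> * (ln \<kappa>)\<^sup>2 / 8)"
    by (simp add: field_simps power2_eq_square)
  finally have lnV: "(1 - r) * ln V \<le> (1 - r) * ln 2 + r * (- (ln P + ln Q) / 2 + \<rho> * (ln \<kappa>)\<^sup>2 / 8)"
    unfolding r\<rho> .
  have root: "2 * sqrt (P * Q) = exp (ln 2 + (ln P + ln Q) / 2)"
    using assms by (simp add: exp_add powr_def ln_mult flip: powr_half_sqrt)
  have pos: "x powr r + y powr r > 0"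
    using False by (auto intro: add_pos_nonneg add_nonneg_pos)
  have "ln (x powr r + y powr r) \<le> ln (S powr r * V powr (1 - r))"
    using le1 pos by simp
  also have "\<dots> = r * ln S + (1 - r) * ln V"
    using S V by (simp add: ln_mult ln_powr)
  finally have "ln (x powr r + y powr r) \<le> r * ln S + (1 - r) * ln V" .
  with lnV have "ln (x powr r + y powr r) - ln 2
      \<le> r * ln S + (1 - r) * ln 2 + r * (- (ln P + ln Q) / 2 + \<rho> * (ln \<kappa>)\<^sup>2 / 8) - ln 2"
    by linarith
  also have "\<dots> = r * (ln S - ln 2 - (ln P + ln Q) / 2 + \<rho> * (ln \<kappa>)\<^sup>2 / 8)"
    by (simp add: field_simps)
  finally have "ln ((x powr r + y powr r) / 2) \<le> r * (ln S - ln 2 - (ln P + ln Q) / 2 + \<rho> * (ln \<kappa>)\<^sup>2 / 8)"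
    using pos by (simp add: ln_div)
  then have "1 / r * ln ((x powr r + y powr r) / 2) \<le> ln S - ln 2 - (ln P + ln Q) / 2 + \<rho> * (ln \<kappa>)\<^sup>2 / 8"
    using r01 by (simp add: field_simps)
  then have "pmean r x y \<le> exp (ln S - ln 2 - (ln P + ln Q) / 2 + \<rho> * (ln \<kappa>)\<^sup>2 / 8)"
    using pos by (simp add: pmean_def powr_def)
  then have "2 * sqrt (P * Q) * exp (- \<rho> * (ln \<kappa>)\<^sup>2 / 8) * pmean r x y
     \<le> 2 * sqrt (P * Q) * exp (- \<rho> * (ln \<kappa>)\<^sup>2 / 8) * exp (ln S - ln 2 - (ln P + ln Q) / 2 + \<rho> * (ln \<kappa>)\<^sup>2 / 8)"
    using assms by (intro mult_left_mono) auto
  also have "\<dots> = S"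
    using S unfolding root by (simp flip: exp_add)
  finally show ?thesis by (simp add: S_def)
qed

text \<open>The case \<open>P = 1\<close>, \<open>Q = 1/2\<close>, \<open>\<kappa> = 2\<close>: an
  agreeing entry has weight 1, a differing one \<open>1/2\<close>.\<close>

lemma two_point_free:
  fixes x y \<rho> :: real
  assumes "x \<ge> 0" "y \<ge> 0" "\<rho> > 0" "r = \<rho> / (1 + \<rho>)"
  shows "sqrt 2 * exp (- \<rho> * (ln 2)\<^sup>2 / 8) * pmean r x y \<le> x + 1/2 * y"
proof -
  have "2 * sqrt (1 * (1/2)) = sqrt (2 :: real)"
    by (simp add: real_sqrt_divide real_div_sqrt)
  then show ?thesis
    using pmean_le_weighted_sum[of 1 "1/2" x y \<rho> r 2] assms by simp
qed

text \<open>In the application \<open>p\<close> and \<open>q\<close> count the words of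
  \<open>B\<close> with first entry 0 and 1, and \<open>x\<close>, \<open>y\<close> are the
  quasinorms of the two halves of \<open>f\<close>.\<close>

lemma two_point_selected:
  fixes x y p q \<rho> :: real
  assumes "x \<ge> 0" "y \<ge> 0" "\<rho> > 0" "r = \<rho> / (1 + \<rho>)"
  shows "3 / (2 * sqrt 7) * exp (- \<rho> * (ln 7)\<^sup>2 / 8) * (p + q)\<^sup>2 * pmean r x y
     \<le> (p\<^sup>2 + 1/7 * q\<^sup>2) * x + (1/7 * p\<^sup>2 + q\<^sup>2) * y"
proof (cases "p = 0 \<and> q = 0")
  case True
  then show ?thesis by simp
next
  case False
  define P where "P = p\<^sup>2 + 1/7 * q\<^sup>2"
  define Q where "Q = 1/7 * p\<^sup>2 + q\<^sup>2"
  have "p\<^sup>2 > 0 \<or> q\<^sup>2 > 0" using False by auto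
  then have PQ: "P > 0" "Q > 0" "P \<le> 7 * Q" "Q \<le> 7 * P"
    by (auto simp: P_def Q_def add_pos_nonneg add_nonneg_pos)
  have "(3 / (2 * sqrt 7) * (p + q)\<^sup>2)\<^sup>2 = 9/28 * ((p + q)\<^sup>2)\<^sup>2"
    by (simp add: power_mult_distrib power_divide)
  \<comment> \<open>The subtracted square vanishes at \<open>p / q = (9 + 4 sqrt 2) / 7\<close>, so
    \<open>3 / (2 sqrt 7)\<close> is the best constant for the weight \<open>1/7\<close>.\<close>
  also have "\<dots> = 4 * (P * Q) - (7 * p\<^sup>2 - 18 * (p * q) + 7 * q\<^sup>2)\<^sup>2 / 196"
    by (simp add: P_def Q_def power2_eq_square field_simps)
  also have "\<dots> \<le> 4 * (P * Q)" by simp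
  finally have "(3 / (2 * sqrt 7) * (p + q)\<^sup>2)\<^sup>2 \<le> 4 * (P * Q)" .
  then have "3 / (2 * sqrt 7) * (p + q)\<^sup>2 \<le> sqrt (4 * (P * Q))"
    by (rule real_le_rsqrt)
  also have "sqrt (4 * (P * Q)) = 2 * sqrt (P * Q)" by (simp add: real_sqrt_mult)
  finally have "3 / (2 * sqrt 7) * (p + q)\<^sup>2 * (exp (- \<rho> * (ln 7)\<^sup>2 / 8) * pmean r x y)
     \<le> 2 * sqrt (P * Q) * (exp (- \<rho> * (ln 7)\<^sup>2 / 8) * pmean r x y)"
    by (rule mult_right_mono) (simp add: pmean_nonneg)
  also have "\<dots> \<le> P * x + Q * y"
    using pmean_le_weighted_sum[of P Q x y \<rho> r 7] PQ assms by (simp add: mult.assoc)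
  finally show ?thesis by (simp add: P_def Q_def mult_ac)
qed


section \<open>Tensorization\<close>

text \<open>Normalised by \<open>2 ^ n\<close>, so that it is an iterated \<open>pmean\<close> and
  the indicator of a set has the density of the set to the power \<open>1/r\<close>.\<close>

definition pnorm :: "real \<Rightarrow> nat \<Rightarrow> (int list \<Rightarrow> real) \<Rightarrow> real" where
  "pnorm r n f = ((\<Sum>a\<in>binvecs n. f a powr r) / 2 ^ n) powr (1 / r)"

fun select :: "bool list \<Rightarrow> 'a list \<Rightarrow> 'a list" where
  "select (t # ts) (y # ys) = (if t then y # select ts ys else select ts ys)"
| "select _ _ = []"

text \<open>Defined on the difference vector instead of the pair, so that distinct differences can
  be summed inside the set of all ternary vectors.\<close>

fun weight :: "real \<Rightarrow> real \<Rightarrow> bool list \<Rightarrow> int list \<Rightarrow> real" where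
  "weight l m (t # ts) (d # ds) = (if d = 0 then 1 else if t then l else m) * weight l m ts ds"
| "weight l m _ _ = 1"

lemma weight_nonneg: "0 \<le> l \<Longrightarrow> 0 \<le> m \<Longrightarrow> 0 \<le> weight l m ts ds"
  by (induction l m ts ds rule: weight.induct) auto

lemma binvecs_0: "binvecs 0 = {[]}"
  by (auto simp: binvecs_def)

lemma binvecs_Suc: "binvecs (Suc n) = (#) 0 ` binvecs n \<union> (#) 1 ` binvecs n"
  by (auto simp: binvecs_def length_Suc_conv)

lemma finite_binvecs: "finite (binvecs n)"
  by (induction n) (auto simp: binvecs_0 binvecs_Suc)

lemma sum_binvecs_Suc:
  "(\<Sum>a\<in>binvecs (Suc n). h a) = (\<Sum>a\<in>binvecs n. h (0 # a) + h (1 # a))"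
  for h :: "int list \<Rightarrow> 'a :: comm_monoid_add"
proof -
  have "(\<Sum>a\<in>binvecs (Suc n). h a) = (\<Sum>a\<in>(#) 0 ` binvecs n. h a) + (\<Sum>a\<in>(#) 1 ` binvecs n. h a)"
    unfolding binvecs_Suc by (rule sum.union_disjoint) (auto simp: finite_binvecs)
  then show ?thesis
    by (simp add: sum.reindex sum.distrib)
qed

lemma card_binvecs: "card (binvecs n) = 2 ^ n"
  using sum_binvecs_Suc[of "\<lambda>_. 1 :: nat"] by (induction n) (auto simp: binvecs_0)

lemma pnorm_nonneg: "0 \<le> pnorm r n f"
  by (simp add: pnorm_def)

lemma pnorm_powr: "r > 0 \<Longrightarrow> pnorm r n f powr r = (\<Sum>a\<in>binvecs n. f a powr r) / 2 ^ n"
  by (simp add: pnorm_def powr_powr sum_nonneg)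

text \<open>Fubini with the first coordinate outermost: the form for a selected coordinate, at which
  \<open>B\<close> splits into two fibres.\<close>

lemma pnorm_Suc:
  assumes "r > 0"
  shows "pnorm r (Suc n) f = pmean r (pnorm r n (\<lambda>a. f (0 # a))) (pnorm r n (\<lambda>a. f (1 # a)))"
  using assms by (simp add: pmean_def pnorm_powr)
    (simp add: pnorm_def sum_binvecs_Suc sum.distrib add_divide_distrib mult.commute)

text \<open>Fubini with the first coordinate innermost: the form for an unselected coordinate, at
  which \<open>f\<close> is replaced by its fibrewise mean.\<close>

lemma pnorm_Suc':
  assumes "r > 0"
  shows "pnorm r (Suc n) f = pnorm r n (\<lambda>a. pmean r (f (0 # a)) (f (1 # a)))"
  using assms by (simp add: pnorm_def pmean_powr sum_binvecs_Suc mult.commute flip: sum_divide_distrib)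

text \<open>On a coordinate outside the selection the two-point inequality is applied for each \<open>b\<close>
  separately and \<open>b\<close> just loses that entry, which keeps its selection injective; only the selected
  coordinates split \<open>B\<close>. The exponent 2 of \<open>card B\<close> is the \<open>1/2\<close>-quasinorm of an indicator.\<close>

lemma weighted_sum_ge:
  fixes c d l m r :: real
  assumes r: "r > 0" and lm: "l \<ge> 0" "m \<ge> 0"
    and sel: "\<And>p q x y. x \<ge> 0 \<Longrightarrow> y \<ge> 0 \<Longrightarrow>
      c * (p + q)\<^sup>2 * pmean r x y \<le> (p\<^sup>2 + l * q\<^sup>2) * x + (l * p\<^sup>2 + q\<^sup>2) * y"
    and free: "\<And>x y. x \<ge> 0 \<Longrightarrow> y \<ge> 0 \<Longrightarrow> d * pmean r x y \<le> x + m * y"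
    and cd: "c \<ge> 0" "d \<ge> 0"
    and "B \<subseteq> binvecs (length ts)" "inj_on (select ts) B" "\<And>a. 0 \<le> f a"
  shows "prod_list (map (\<lambda>t. if t then c else d) ts) * (real (card B))\<^sup>2 * pnorm r (length ts) f
     \<le> (\<Sum>b\<in>B. \<Sum>a\<in>binvecs (length ts). weight l m ts (map2 (-) a b) * f a)"
  using assms(8-)
proof (induction ts arbitrary: f B)
  case Nil
  then have "B = {} \<or> B = {[]}" by (auto simp: binvecs_0)
  then show ?case
    using r Nil by (auto simp: binvecs_0 pnorm_def powr_powr)
next
  case (Cons t ts)
  define n where "n = length ts"
  define C where "C = prod_list (map (\<lambda>t. if t then c else d) ts)"
  have C: "C \<ge> 0" unfolding C_def using cd by (induction ts) auto
  have finB: "finite B" using Cons.prems finite_binvecs finite_subset by blast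
  note IH = Cons.IH[folded n_def C_def]
  let ?w = "weight l m ts"
  show ?case
  proof (cases t)
    case True
    define Bj where "Bj = (\<lambda>j. {b. j # b \<in> B})"
    have sub: "Bj j \<subseteq> binvecs n" for j
      by (auto simp: Bj_def n_def binvecs_Suc dest!: subsetD[OF Cons.prems(1)])
    \<comment> \<open>The first entry is selected but constant on a fibre, so the other selected
      entries separate the fibre.\<close>
    have inj: "inj_on (select ts) (Bj j)" for j
    proof (rule inj_onI)
      fix x y assume "x \<in> Bj j" "y \<in> Bj j" "select ts x = select ts y"
      then show "x = y"
        using inj_onD[OF Cons.prems(2), of "j # x" "j # y"] True by (simp add: Bj_def)
    qed
    define p q where "p = real (card (Bj 0))" and "q = real (card (Bj 1))"
    define F0 F1 where "F0 = pnorm r n (\<lambda>a. f (0 # a))" and "F1 = pnorm r n (\<lambda>a. f (1 # a))"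
    have B: "B = (#) 0 ` Bj 0 \<union> (#) 1 ` Bj 1"
      using Cons.prems(1) by (auto simp: Bj_def binvecs_Suc)
    have fin: "finite (Bj j)" for j using sub finite_binvecs finite_subset by blast
    have sumB: "sum h B = (\<Sum>b\<in>Bj 0. h (0 # b)) + (\<Sum>b\<in>Bj 1. h (1 # b))" for h :: "int list \<Rightarrow> real"
    proof -
      have "sum h B = sum h ((#) 0 ` Bj 0) + sum h ((#) 1 ` Bj 1)"
        by (subst B, rule sum.union_disjoint) (auto simp: fin)
      then show ?thesis by (simp add: sum.reindex)
    qed
    have cardB: "real (card B) = p + q"
      using sumB[of "\<lambda>_. 1"] by (simp add: p_def q_def)
    \<comment> \<open>\<open>i\<close> and \<open>j\<close> are the first entries of
      \<open>a\<close> and \<open>b\<close>; the factor \<open>l\<close> of the blocks with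
      \<open>i \<noteq> j\<close> is kept outside.\<close>
    define S where "S = (\<lambda>i j. \<Sum>b\<in>Bj j. \<Sum>a\<in>binvecs n. ?w (map2 (-) a b) * f (i # a))"
    have S: "S 0 0 \<ge> C * p\<^sup>2 * F0" "S 1 0 \<ge> C * p\<^sup>2 * F1" "S 0 1 \<ge> C * q\<^sup>2 * F0" "S 1 1 \<ge> C * q\<^sup>2 * F1"
      unfolding S_def p_def q_def F0_def F1_def using Cons.prems(3)
      by (auto intro!: IH sub inj)
    have "(\<Sum>b\<in>B. \<Sum>a\<in>binvecs (Suc n). weight l m (t # ts) (map2 (-) a b) * f a)
       = S 0 0 + l * S 1 0 + l * S 0 1 + S 1 1"
      using True by (simp add: sumB sum_binvecs_Suc S_def sum.distrib sum_distrib_left mult_ac)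
    also have "\<dots> \<ge> C * p\<^sup>2 * F0 + l * (C * p\<^sup>2 * F1) + l * (C * q\<^sup>2 * F0) + C * q\<^sup>2 * F1"
      using S lm by (intro add_mono mult_left_mono) auto
    also have "C * p\<^sup>2 * F0 + l * (C * p\<^sup>2 * F1) + l * (C * q\<^sup>2 * F0) + C * q\<^sup>2 * F1
       = C * ((p\<^sup>2 + l * q\<^sup>2) * F0 + (l * p\<^sup>2 + q\<^sup>2) * F1)"
      by (simp add: algebra_simps)
    \<comment> \<open>Here \<open>p + q\<close> is the size of \<open>B\<close>, so the exponent 2
      survives the induction.\<close>
    also have "\<dots> \<ge> C * (c * (p + q)\<^sup>2 * pmean r F0 F1)"
      by (intro mult_left_mono sel C) (auto simp: F0_def F1_def pnorm_nonneg)
    finally show ?thesis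
      using True r by (simp add: cardB pnorm_Suc C_def n_def F0_def F1_def mult_ac)
  next
    case False
    define F where "F = (\<lambda>a. pmean r (f (0 # a)) (f (1 # a)))"
    have sel_tl: "select (t # ts) b = select ts (tl b)" if "b \<in> B" for b
      using that Cons.prems(1) False by (cases b) (auto simp: binvecs_def)
    \<comment> \<open>The selection factors through \<open>tl\<close>, so dropping the first entry
      loses no words of \<open>B\<close>.\<close>
    have "inj_on (select ts \<circ> tl) B"
      using Cons.prems(2) sel_tl by (simp cong: inj_on_cong)
    then have inj: "inj_on tl B" "inj_on (select ts) (tl ` B)"
      by (auto dest: inj_on_imageI inj_on_imageI2)
    have "C * (real (card B))\<^sup>2 * pnorm r n F \<le> (\<Sum>b\<in>tl ` B. \<Sum>a\<in>binvecs n. ?w (map2 (-) a b) * F a)"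
    proof (subst card_image[OF inj(1), symmetric], rule IH)
      show "tl ` B \<subseteq> binvecs n"
        using Cons.prems(1) by (auto simp: binvecs_Suc n_def)
    qed (use inj in \<open>auto simp: F_def pmean_nonneg\<close>)
    then have "d * (C * (real (card B))\<^sup>2 * pnorm r n F) \<le> d * (\<Sum>b\<in>tl ` B. \<Sum>a\<in>binvecs n. ?w (map2 (-) a b) * F a)"
      using cd by (intro mult_left_mono)
    also have "\<dots> = (\<Sum>b\<in>B. \<Sum>a\<in>binvecs n. ?w (map2 (-) a (tl b)) * (d * F a))"
      by (simp add: sum.reindex[OF inj(1)] sum_distrib_left mult_ac)
    also have "\<dots> \<le> (\<Sum>b\<in>B. \<Sum>a\<in>binvecs (Suc n). weight l m (t # ts) (map2 (-) a b) * f a)"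
    proof (rule sum_mono)
      fix b assume "b \<in> B"
      then obtain b1 b' where b: "b = b1 # b'" "b1 = 0 \<or> b1 = 1"
        using Cons.prems(1) by (auto simp: binvecs_Suc)
      have "?w (map2 (-) a b') * (d * F a) \<le> weight l m (t # ts) (map2 (-) (0 # a) b) * f (0 # a)
          + weight l m (t # ts) (map2 (-) (1 # a) b) * f (1 # a)" for a
      proof -
        \<comment> \<open>Whichever value \<open>b1\<close> has, the agreeing entry of
          \<open>a\<close> has weight 1 and the other \<open>m\<close>; \<open>pmean\<close> is
          symmetric.\<close>
        have "?w (map2 (-) a b') * (d * F a) \<le> ?w (map2 (-) a b') * (f (b1 # a) + m * f ((1 - b1) # a))"
          using b(2) free[of "f (0 # a)" "f (1 # a)"] free[of "f (1 # a)" "f (0 # a)"] Cons.prems(3) lm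
          by (intro mult_left_mono weight_nonneg) (auto simp: F_def pmean_commute)
        also have "\<dots> = weight l m (t # ts) (map2 (-) (0 # a) b) * f (0 # a)
          + weight l m (t # ts) (map2 (-) (1 # a) b) * f (1 # a)"
          using b False by (auto simp: algebra_simps)
        finally show ?thesis .
      qed
      then show "(\<Sum>a\<in>binvecs n. ?w (map2 (-) a (tl b)) * (d * F a))
         \<le> (\<Sum>a\<in>binvecs (Suc n). weight l m (t # ts) (map2 (-) a b) * f a)"
        unfolding sum_binvecs_Suc using b(1) by (auto intro!: sum_mono)
    qed
    finally show ?thesis
      using False r by (simp add: pnorm_Suc' C_def n_def F_def mult_ac)
  qed
qed

text \<open>The weight is a product, so the sum factors; a coordinate contributes 1 for the entry 0
  and its weight once each for -1 and 1.\<close>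

lemma sum_weight_ternary:
  "(\<Sum>v | length v = length ts \<and> set v \<subseteq> {-1, 0, 1}. weight l m ts v)
     = prod_list (map (\<lambda>t. if t then 1 + 2 * l else 1 + 2 * m) ts)"
proof (induction ts)
  case Nil
  have "{v :: int list. v = [] \<and> set v \<subseteq> {-1, 0, 1}} = {[]}" by auto
  then show ?case by simp
next
  case (Cons t ts)
  let ?V = "{v :: int list. length v = length ts \<and> set v \<subseteq> {-1, 0, 1}}"
  have fin: "finite ?V"
    using finite_lists_length_eq[of "{-1, 0, 1 :: int}" "length ts"] by (simp add: conj_commute)
  have V: "{v :: int list. length v = length (t # ts) \<and> set v \<subseteq> {-1, 0, 1}}
      = (\<lambda>(x, v). x # v) ` ({-1, 0, 1} \<times> ?V)"
    by (auto simp: length_Suc_conv)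
  have "(\<Sum>v | length v = length (t # ts) \<and> set v \<subseteq> {-1, 0, 1}. weight l m (t # ts) v)
     = (\<Sum>x\<in>{-1, 0, 1}. \<Sum>v\<in>?V. weight l m (t # ts) (x # v))"
    unfolding V by (subst sum.reindex) (auto simp: inj_on_def sum.cartesian_product case_prod_unfold)
  also have "\<dots> = (\<Sum>x\<in>{-1, 0, 1 :: int}. if x = 0 then 1 else if t then l else m) * (\<Sum>v\<in>?V. weight l m ts v)"
    by (simp only: weight.simps sum_distrib_left[symmetric] sum_distrib_right[symmetric])
  finally show ?case using Cons.IH by simp
qed

lemma prod_list_if_eq_power:
  "prod_list (map (\<lambda>t. if t then x else y) ts) = x ^ count_list ts True * y ^ count_list ts False"
  for x y :: "'a :: comm_monoid_mult"
  by (induction ts) (auto simp: mult_ac)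

lemma count_list_True_False: "count_list ts True + count_list ts False = length ts"
  by (induction ts) auto


section \<open>Uniquely decodable code pairs\<close>

lemma binvecs_nth: "a \<in> binvecs n \<Longrightarrow> i < n \<Longrightarrow> a ! i = 0 \<or> a ! i = 1"
  using nth_mem[of i a] by (auto simp: binvecs_def simp del: nth_mem)

lemma length_binvecs: "a \<in> binvecs n \<Longrightarrow> length a = n"
  by (simp add: binvecs_def)

lemma map2_diff_ternary:
  assumes "a \<in> binvecs n" "b \<in> binvecs n"
  shows "length (map2 (-) a b) = n \<and> set (map2 (-) a b) \<subseteq> {-1, 0, 1}"
proof (intro conjI subsetI)
  show len: "length (map2 (-) a b) = n" using assms by (simp add: length_binvecs)
  fix x assume "x \<in> set (map2 (-) a b)"
  then obtain i where "i < n" "x = map2 (-) a b ! i"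
    unfolding in_set_conv_nth len by blast
  then have "i < n" "x = a ! i - b ! i" using assms by (auto simp: length_binvecs)
  then show "x \<in> {-1, 0, 1}"
    using binvecs_nth[OF assms(1), of i] binvecs_nth[OF assms(2), of i] by auto
qed

lemma udcp_finite:
  assumes "udcp n A B"
  shows "finite A" "finite B"
  using assms by (auto simp: udcp_def intro: finite_subset[OF _ finite_binvecs])

text \<open>A map on a finite set whose image is as large as its domain is injective.\<close>

lemma udcp_inj_sum:
  assumes "udcp n A B"
  shows "inj_on (\<lambda>(a, b). map2 (+) a b) (A \<times> B)"
proof (rule eq_card_imp_inj_on)
  show "finite (A \<times> B)"
    using udcp_finite[OF assms] by simp
  have "(\<lambda>(a, b). map2 (+) a b) ` (A \<times> B) = sumset A B"
    by (auto simp: sumset_def)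
  then show "card ((\<lambda>(a, b). map2 (+) a b) ` (A \<times> B)) = card (A \<times> B)"
    using assms by (simp add: udcp_def card_cartesian_product)
qed

text \<open>\<open>a - b = a' - b'\<close> rearranges to \<open>a + b' = a' + b\<close>, a
  coincidence of sums after swapping partners.\<close>

lemma udcp_inj_diff:
  assumes "udcp n A B"
  shows "inj_on (\<lambda>(a, b). map2 (-) a b) (A \<times> B)"
proof (rule inj_onI, clarify)
  fix a b a' b' assume mem: "a \<in> A" "b \<in> B" "a' \<in> A" "b' \<in> B"
    and eq: "map2 (-) a b = map2 (-) a' b'"
  have len: "length a = n" "length b = n" "length a' = n" "length b' = n"
    using mem assms by (auto simp: udcp_def binvecs_def)
  have "a ! i - b ! i = a' ! i - b' ! i" if "i < n" for i
    using arg_cong[OF eq, of "\<lambda>v. v ! i"] that len by simp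
  then have "map2 (+) a b' = map2 (+) a' b"
    using len by (intro nth_equalityI) (auto simp: algebra_simps)
  then show "a = a' \<and> b = b'"
    using inj_onD[OF udcp_inj_sum[OF assms], of "(a, b')" "(a', b)"] mem by simp
qed

section \<open>Choice of the coordinate set\<close>

lemma select_eq_nth:
  assumes "select ts x = select ts y" "length x = length ts" "length y = length ts"
    "i < length ts" "ts ! i"
  shows "x ! i = y ! i"
  using assms
proof (induction ts arbitrary: x y i)
  case (Cons t ts)
  then obtain x0 x' y0 y' where xy: "x = x0 # x'" "y = y0 # y'"
    by (metis length_Suc_conv)
  show ?case
  proof (cases i)
    case 0
    then show ?thesis using Cons.prems xy by simp
  next
    case (Suc j)
    have "x' ! j = y' ! j"
      by (rule Cons.IH) (use Cons.prems xy Suc in \<open>auto split: if_splits\<close>)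
    then show ?thesis using xy Suc by simp
  qed
qed simp

lemma select_in_binvecs: "b \<in> binvecs (length ts) \<Longrightarrow> select ts b \<in> binvecs (count_list ts True)"
  by (induction ts arbitrary: b) (auto simp: binvecs_0 binvecs_Suc)

text \<open>Yields the crude bound \<open>\<beta> - \<epsilon> \<le> 1/2\<close>, which serves for
  large \<open>\<epsilon>\<close>.\<close>

lemma card_le_if_inj_select:
  assumes "B \<subseteq> binvecs (length ts)" "inj_on (select ts) B"
  shows "card B \<le> 2 ^ count_list ts True"
proof -
  have "card B \<le> card (binvecs (count_list ts True))"
    using assms select_in_binvecs[of _ ts] by (intro card_inj_on_le finite_binvecs) auto
  then show ?thesis by (simp add: card_binvecs)
qed

text \<open>Pigeonhole over the \<open>2 ^ n\<close> patterns of differing coordinates. For a fixed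
  pattern \<open>b\<close> determines \<open>a\<close> by flipping bits, so pairs can be counted by
  their second components.\<close>

lemma udcp_popular_distance:
  assumes "udcp n A B"
  obtains ts B' where "length ts = n" "B' \<subseteq> B" "card A * card B \<le> 2 ^ n * card B'"
    "\<And>b. b \<in> B' \<Longrightarrow> \<exists>a\<in>A. map2 (\<noteq>) a b = ts"
proof -
  let ?f = "\<lambda>(a, b). map2 (\<noteq>) a b"
  let ?T = "{ts :: bool list. length ts = n}"
  have T: "card ?T = 2 ^ n" "finite ?T"
    using card_lists_length_eq[of "UNIV :: bool set" n] finite_lists_length_eq[of "UNIV :: bool set" n]
    by simp_all
  have AB: "A \<subseteq> binvecs n" "B \<subseteq> binvecs n" using assms by (auto simp: udcp_def)
  have "?f \<in> A \<times> B \<rightarrow> ?T"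
    using AB by (auto simp: length_binvecs dest!: subsetD)
  moreover have "finite (A \<times> B)"
    using udcp_finite[OF assms] by simp
  moreover have "?T \<noteq> {}"
    using Ex_list_of_length by auto
  ultimately have "\<exists>ts\<in>?T. card (?f -` {ts} \<inter> A \<times> B) * card ?T \<ge> card (A \<times> B)"
    using T(2) by (intro pigeonhole_card)
  then obtain ts where ts: "length ts = n" "card (?f -` {ts} \<inter> A \<times> B) * 2 ^ n \<ge> card (A \<times> B)"
    unfolding T(1) by (elim bexE) (simp only: mem_Collect_eq)
  let ?F = "?f -` {ts} \<inter> A \<times> B"
  have "inj_on snd ?F"
  proof (rule inj_onI, clarsimp)
    fix a a' b assume mem: "a \<in> A" "a' \<in> A" "b \<in> B" and eq: "map2 (\<noteq>) a' b = map2 (\<noteq>) a b"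
    then have bin: "a \<in> binvecs n" "a' \<in> binvecs n" "b \<in> binvecs n" using AB by auto
    then have len: "length a = n" "length a' = n" "length b = n" by (auto simp: length_binvecs)
    have "a ! i = a' ! i" if "i < n" for i
      using binvecs_nth[OF bin(1) that] binvecs_nth[OF bin(2) that] binvecs_nth[OF bin(3) that]
        arg_cong[OF eq, of "\<lambda>v. v ! i"] that len by auto
    then show "a = a'"
      using len by (intro nth_equalityI) auto
  qed
  then have "card (snd ` ?F) = card ?F" by (rule card_image)
  with ts have "card A * card B \<le> 2 ^ n * card (snd ` ?F)"
    by (simp add: card_cartesian_product mult.commute)
  then show thesis
    by (intro that[of ts "snd ` ?F"]) (use ts in auto)
qed

text \<open>On pairs with a fixed set \<open>ts\<close> of differing coordinates, \<open>a + b\<close> depends only on \<open>b\<close> outside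
  \<open>ts\<close>, and \<open>a - b\<close> only on \<open>b\<close> inside \<open>ts\<close>. Unique decodability therefore makes both projections
  of \<open>b\<close> injective, and one of them uses at most half of the coordinates.\<close>

lemma udcp_obtain_selection:
  assumes "udcp n A B"
  obtains ts B' where "length ts = n" "B' \<subseteq> B" "card A * card B \<le> 2 ^ n * card B'"
    "inj_on (select ts) B'" "2 * count_list ts True \<le> n"
proof -
  obtain ts B' where ts: "length ts = n" "B' \<subseteq> B" "card A * card B \<le> 2 ^ n * card B'"
    and mask: "\<And>b. b \<in> B' \<Longrightarrow> \<exists>a\<in>A. map2 (\<noteq>) a b = ts"
    using udcp_popular_distance[OF assms] by metis
  have AB: "A \<subseteq> binvecs n" "B \<subseteq> binvecs n" using assms by (auto simp: udcp_def)
  have inj: "inj_on (select us) B'" if us: "us = ts \<or> us = map Not ts" for us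
  proof (rule inj_onI)
    fix b b' assume b: "b \<in> B'" "b' \<in> B'" and eq: "select us b = select us b'"
    obtain a a' where a: "a \<in> A" "a' \<in> A" "map2 (\<noteq>) a b = ts" "map2 (\<noteq>) a' b' = ts"
      using mask b by meson
    have bin: "a \<in> binvecs n" "b \<in> binvecs n" "a' \<in> binvecs n" "b' \<in> binvecs n"
      using a b AB ts by auto
    have len: "length a = n" "length b = n" "length a' = n" "length b' = n"
      using bin by (auto simp: length_binvecs)
    have eq_nth: "b ! i = b' ! i" if "i < n" "us ! i" for i
      by (rule select_eq_nth[OF eq]) (use that len ts(1) us in auto)
    have ts_nth: "ts ! i = (a ! i \<noteq> b ! i)" "ts ! i = (a' ! i \<noteq> b' ! i)" if "i < n" for i
      using arg_cong[OF a(3), of "\<lambda>v. v ! i"] arg_cong[OF a(4), of "\<lambda>v. v ! i"] that len by auto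
    show "b = b'"
      using us
    proof
      assume "us = ts"
      have "map2 (-) a b = map2 (-) a' b'"
      proof (rule nth_equalityI)
        fix i assume "i < length (map2 (-) a b)"
        then have i: "i < n" using len by simp
        show "map2 (-) a b ! i = map2 (-) a' b' ! i"
          using binvecs_nth[OF bin(1) i] binvecs_nth[OF bin(2) i] binvecs_nth[OF bin(3) i]
            binvecs_nth[OF bin(4) i] ts_nth[OF i] eq_nth[OF i] i len \<open>us = ts\<close>
          by auto
      qed (use len in simp)
      then show "b = b'"
        using inj_onD[OF udcp_inj_diff[OF assms], of "(a, b)" "(a', b')"] a b ts by auto
    next
      assume "us = map Not ts"
      have "map2 (+) a b = map2 (+) a' b'"
      proof (rule nth_equalityI)
        fix i assume "i < length (map2 (+) a b)"
        then have i: "i < n" using len by simp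
        show "map2 (+) a b ! i = map2 (+) a' b' ! i"
          using binvecs_nth[OF bin(1) i] binvecs_nth[OF bin(2) i] binvecs_nth[OF bin(3) i]
            binvecs_nth[OF bin(4) i] ts_nth[OF i] eq_nth[OF i] i len \<open>us = map Not ts\<close> ts
          by auto
      qed (use len in simp)
      then show "b = b'"
        using inj_onD[OF udcp_inj_sum[OF assms], of "(a, b)" "(a', b')"] a b ts by auto
    qed
  qed
  have "count_list (map Not us) True = count_list us False" for us
    by (induction us) auto
  from this[of ts] have "2 * count_list ts True \<le> n \<or> 2 * count_list (map Not ts) True \<le> n"
    using count_list_True_False[of ts] ts(1) by linarith
  then show thesis
  proof
    assume "2 * count_list ts True \<le> n"
    then show thesis by (intro that[of ts B'] ts inj) simp
  next
    assume "2 * count_list (map Not ts) True \<le> n"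
    then show thesis by (intro that[of "map Not ts" B'] ts inj) (simp_all add: ts(1))
  qed
qed

section \<open>Weighted count of differences\<close>

text \<open>Tensorization is applied to the indicator of \<open>A\<close>, with
  \<open>1/r = 1 + 1/\<rho>\<close>. On the right, \<open>9/7 = 1 + 2 * (1/7)\<close> and
  \<open>2 = 1 + 2 * (1/2)\<close>.\<close>

lemma udcp_weighted_bound:
  fixes \<rho> :: real
  assumes "udcp n A B" "B' \<subseteq> B" "length ts = n" "inj_on (select ts) B'" "\<rho> > 0"
  defines "k \<equiv> count_list ts True"
  shows "(3 / (2 * sqrt 7) * exp (- \<rho> * (ln 7)\<^sup>2 / 8)) ^ k * (sqrt 2 * exp (- \<rho> * (ln 2)\<^sup>2 / 8)) ^ (n - k)
      * (real (card B'))\<^sup>2 * (real (card A) / 2 ^ n) powr (1 + 1 / \<rho>) \<le> (9/7) ^ k * 2 ^ (n - k)"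
proof -
  define r where "r = \<rho> / (1 + \<rho>)"
  have r: "r > 0" "1 / r = 1 + 1 / \<rho>" using assms(5) by (auto simp: r_def field_simps)
  define c d where "c = 3 / (2 * sqrt 7) * exp (- \<rho> * (ln 7)\<^sup>2 / 8)"
    and "d = sqrt 2 * exp (- \<rho> * (ln 2)\<^sup>2 / 8)"
  have AB: "A \<subseteq> binvecs n" "B \<subseteq> binvecs n" using assms(1) by (auto simp: udcp_def)
  let ?f = "\<lambda>a. if a \<in> A then 1 else 0 :: real"
  let ?w = "weight (1/7) (1/2) ts"
  let ?V = "{v :: int list. length v = length ts \<and> set v \<subseteq> {-1, 0, 1}}"
  have fin: "finite A" "finite B'" "finite ?V"
    using udcp_finite[OF assms(1)] assms(2) finite_subset[of B' B] finite_lists_length_eq[of "{-1, 0, 1 :: int}" "length ts"]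
    by (auto simp: conj_commute)
  have nk: "count_list ts False = n - k"
    using count_list_True_False[of ts] assms(3) by (simp add: k_def)
  have "(\<Sum>a\<in>binvecs n. ?f a powr r) = (\<Sum>a\<in>binvecs n. if a \<in> A then 1 else 0)"
    by (intro sum.cong) auto
  also have "\<dots> = real (card A)"
    using AB by (simp add: finite_binvecs sum.If_cases inf_absorb2)
  finally have norm: "pnorm r n ?f = (real (card A) / 2 ^ n) powr (1 + 1 / \<rho>)"
    by (simp add: pnorm_def r(2))
  have "prod_list (map (\<lambda>t. if t then c else d) ts) * (real (card B'))\<^sup>2 * pnorm r (length ts) ?f
     \<le> (\<Sum>b\<in>B'. \<Sum>a\<in>binvecs (length ts). ?w (map2 (-) a b) * ?f a)"
  proof (rule weighted_sum_ge)
    fix x y p q :: real assume "x \<ge> 0" "y \<ge> 0"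
    then show "c * (p + q)\<^sup>2 * pmean r x y \<le> (p\<^sup>2 + 1/7 * q\<^sup>2) * x + (1/7 * p\<^sup>2 + q\<^sup>2) * y"
      and "d * pmean r x y \<le> x + 1/2 * y"
      unfolding c_def d_def using assms(5) r_def by (intro two_point_selected two_point_free; simp)+
  qed (use AB assms(2-4) r in \<open>auto simp: c_def d_def\<close>)
  then have "c ^ k * d ^ (n - k) * (real (card B'))\<^sup>2 * pnorm r n ?f
     \<le> (\<Sum>b\<in>B'. \<Sum>a\<in>binvecs n. ?w (map2 (-) a b) * ?f a)"
    unfolding prod_list_if_eq_power nk assms(3) k_def .
  also have "\<dots> = (\<Sum>b\<in>B'. \<Sum>a\<in>A. ?w (map2 (-) a b))"
    using AB by (intro sum.cong refl sum.mono_neutral_cong_right) (auto simp: finite_binvecs)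
  also have "\<dots> = (\<Sum>(a, b)\<in>A \<times> B'. ?w (map2 (-) a b))"
    by (subst sum.swap) (simp add: sum.cartesian_product)
  also have "\<dots> = (\<Sum>v\<in>(\<lambda>(a, b). map2 (-) a b) ` (A \<times> B'). ?w v)"
  proof -
    have "inj_on (\<lambda>(a, b). map2 (-) a b) (A \<times> B')"
      using udcp_inj_diff[OF assms(1)] by (rule inj_on_subset) (use assms(2) in auto)
    then show ?thesis by (simp add: sum.reindex case_prod_unfold)
  qed
  \<comment> \<open>Weights are nonnegative, so the sum may be extended from the differences that
    occur to all ternary vectors.\<close>
  also have "\<dots> \<le> (\<Sum>v\<in>?V. ?w v)"
  proof (rule sum_mono2[OF fin(3)])
    show "(\<lambda>(a, b). map2 (-) a b) ` (A \<times> B') \<subseteq> ?V"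
    proof (rule image_subsetI)
      fix p assume "p \<in> A \<times> B'"
      then have "fst p \<in> binvecs n" "snd p \<in> binvecs n" using AB assms(2) by auto
      from map2_diff_ternary[OF this] show "(case p of (a, b) \<Rightarrow> map2 (-) a b) \<in> ?V"
        using assms(3) by (simp only: case_prod_unfold mem_Collect_eq)
    qed
  qed (simp add: weight_nonneg)
  also have "\<dots> = (9/7) ^ k * 2 ^ (n - k)"
    unfolding sum_weight_ternary prod_list_if_eq_power nk k_def by simp
  finally show ?thesis
    by (simp add: norm c_def d_def)
qed

section \<open>From the count to the rate\<close>

lemma card_udcp_le:
  assumes "udcp n A B"
  shows "card B \<le> 2 ^ n"
  using assms card_mono[OF finite_binvecs] by (auto simp: udcp_def card_binvecs[symmetric])

text \<open>\<open>lA\<close> and \<open>lN\<close> stand for the logarithms of the sizes of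
  \<open>A\<close> and \<open>B'\<close>; \<open>g\<close> and \<open>L / 2\<close> are the costs of
  a selected and an unselected coordinate, and \<open>x\<close>, \<open>y\<close> their losses per
  unit of \<open>\<rho>\<close>.\<close>

lemma rate_le_of_log_inequality:
  fixes \<epsilon> \<beta> g \<rho> lA lN x y :: real and n k :: nat
  defines "L \<equiv> ln 2"
  assumes "n \<ge> 1" "2 * k \<le> n" "\<rho> > 0" "\<epsilon> \<ge> 0"
    and lA: "lA - real n * L \<ge> - (\<epsilon> * real n * L)"
    and lN: "lN \<ge> (\<beta> - \<epsilon>) * real n * L"
    and g: "L / 2 \<le> g" "2 * g + L \<le> 37/11 * L"
    and xy: "y \<le> x" "x + y \<le> L"
    and main: "2 * lN + (1 + 1 / \<rho>) * (lA - real n * L) \<le> real k * (g + \<rho> * x) + (real n - real k) * (L / 2 + \<rho> * y)"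
  shows "\<beta> \<le> 37/88 + 3/2 * \<epsilon> + \<epsilon> / (2 * \<rho>) + \<rho> / 4"
proof -
  have L: "L > 0" by (simp add: L_def)
  have n: "real n > 0" using assms by simp
  \<comment> \<open>The cost is affine in \<open>k\<close> with nonnegative slope, so
    \<open>k = n / 2\<close> is the worst case.\<close>
  have k_le: "real k * (g - L / 2 + \<rho> * (x - y)) \<le> real n / 2 * (g - L / 2 + \<rho> * (x - y))"
    using assms by (intro mult_right_mono add_nonneg_nonneg) auto
  have "real k * (g + \<rho> * x) + (real n - real k) * (L / 2 + \<rho> * y)
      = real k * (g - L / 2 + \<rho> * (x - y)) + real n * (L / 2 + \<rho> * y)"
    by (simp add: algebra_simps add_divide_distrib diff_divide_distrib)
  also have "\<dots> \<le> real n / 2 * (g - L / 2 + \<rho> * (x - y)) + real n * (L / 2 + \<rho> * y)"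
    using k_le by (rule add_right_mono)
  also have "\<dots> = real n * ((2 * g + L + 2 * (\<rho> * (x + y))) / 4)"
    by (simp add: algebra_simps add_divide_distrib diff_divide_distrib)
  also have "\<dots> \<le> real n * ((37/11 * L + 2 * (\<rho> * L)) / 4)"
    using g(2) xy(2) n \<open>\<rho> > 0\<close> by (intro mult_left_mono divide_right_mono add_mono) simp_all
  also have "\<dots> = real n * L * (37/44 + \<rho> / 2)"
    by (simp add: algebra_simps add_divide_distrib)
  finally have le: "real k * (g + \<rho> * x) + (real n - real k) * (L / 2 + \<rho> * y) \<le> real n * L * (37/44 + \<rho> / 2)" .
  have "(1 + 1 / \<rho>) * - (\<epsilon> * real n * L) \<le> (1 + 1 / \<rho>) * (lA - real n * L)"
    using assms by (intro mult_left_mono) auto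
  then have "2 * ((\<beta> - \<epsilon>) * real n * L) \<le> (1 + 1 / \<rho>) * (\<epsilon> * real n * L) + real n * L * (37/44 + \<rho> / 2)"
    using main lN le by linarith
  then have "(real n * L) * (2 * (\<beta> - \<epsilon>)) \<le> (real n * L) * ((1 + 1 / \<rho>) * \<epsilon> + (37/44 + \<rho> / 2))"
    by (simp add: algebra_simps)
  then have "2 * (\<beta> - \<epsilon>) \<le> (1 + 1 / \<rho>) * \<epsilon> + (37/44 + \<rho> / 2)"
    using n L by simp
  then show ?thesis
    by (simp add: field_simps)
qed

lemma ln_constants:
  "ln 2 / 2 \<le> ln (36/7 :: real) / 2" "2 * (ln (36/7 :: real) / 2) + ln 2 \<le> 37/11 * ln 2"
  "(ln 2)\<^sup>2 / 8 \<le> (ln 7 :: real)\<^sup>2 / 8" "(ln 7 :: real)\<^sup>2 / 8 + (ln 2)\<^sup>2 / 8 \<le> ln 2"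
proof -
  show "ln 2 / 2 \<le> ln (36/7 :: real) / 2" by simp
  \<comment> \<open>\<open>37/11\<close> is a rational number just above \<open>log2 (72/7)\<close>;
    it leads to \<open>37/88 < 0.4205\<close>.\<close>
  have "11 * ln (72/7 :: real) = ln ((72/7) ^ 11)" by (simp add: ln_realpow)
  also have "\<dots> \<le> ln (2 ^ 37 :: real)" by (subst ln_le_cancel_iff) (simp_all add: power_divide)
  also have "\<dots> = 37 * ln 2" by (subst ln_realpow) simp_all
  finally have "11 * ln (72/7 :: real) \<le> 37 * ln 2" .
  moreover have "ln (36/7 :: real) + ln 2 = ln (72/7)" using ln_mult[of "36/7" "2 :: real"] by simp
  ultimately show "2 * (ln (36/7 :: real) / 2) + ln 2 \<le> 37/11 * ln 2" by simp
  show "(ln 2)\<^sup>2 / 8 \<le> (ln 7 :: real)\<^sup>2 / 8"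
    by (intro divide_right_mono power_mono) auto
  have "ln (7 :: real) \<le> ln (2 ^ 3)" by (subst ln_le_cancel_iff) auto
  also have "\<dots> = 3 * ln 2" by (subst ln_realpow) simp_all
  finally have "ln (7 :: real) \<le> 25/12" using ln2_le_25_over_36 by simp
  then have "(ln (7 :: real))\<^sup>2 \<le> (25/12)\<^sup>2" by (intro power_mono) auto
  moreover have "(ln (2 :: real))\<^sup>2 \<le> (25/36)\<^sup>2" using ln2_le_25_over_36 by (intro power_mono) auto
  ultimately show "(ln 7 :: real)\<^sup>2 / 8 + (ln 2)\<^sup>2 / 8 \<le> ln 2"
    using ln2_ge_two_thirds by (simp add: power_divide)
qed

theorem theorem1:
  fixes n :: nat and \<epsilon> \<beta> :: real and A B :: "int list set"
  assumes "n \<ge> 1" and "\<epsilon> \<ge> 0" and "\<beta> \<ge> 0"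
    and "udcp n A B"
    and "real (card A) \<ge> 2 powr ((1 - \<epsilon>) * real n)"
    and "real (card B) = 2 powr (\<beta> * real n)"
  shows "\<beta> \<le> 0.4228 + sqrt \<epsilon>"
proof -
  define \<sigma> where "\<sigma> = sqrt \<epsilon>"
  have \<sigma>: "\<sigma> \<ge> 0" "\<epsilon> = \<sigma>\<^sup>2" using assms(2) by (auto simp: \<sigma>_def)
  have n: "real n > 0" using assms(1) by simp
  obtain ts B' where ts: "length ts = n" "B' \<subseteq> B" "card A * card B \<le> 2 ^ n * card B'"
    "inj_on (select ts) B'" "2 * count_list ts True \<le> n"
    using udcp_obtain_selection[OF assms(4)] by metis
  define k where "k = count_list ts True"
  have k: "2 * k \<le> n" using ts(5) by (simp add: k_def)
  have posA: "real (card A) > 0" by (rule less_le_trans[OF _ assms(5)]) simp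
  have posB: "real (card B) > 0" using assms(6) by simp
  have "real (card A * card B) \<le> real (2 ^ n * card B')"
    using ts(3) by (simp only: of_nat_le_iff)
  then have le: "real (card A) * real (card B) \<le> 2 ^ n * real (card B')" by simp
  then have posN: "real (card B') > 0"
    using mult_pos_pos[OF posA posB] by (cases "card B' = 0") auto
  have "ln (2 powr ((1 - \<epsilon>) * real n)) \<le> ln (real (card A))"
    using assms(5) posA by (subst ln_le_cancel_iff) auto
  then have lnA: "ln (real (card A)) \<ge> (1 - \<epsilon>) * real n * ln 2"
    by (simp add: ln_powr)
  have lnB: "ln (real (card B)) = \<beta> * real n * ln 2"
    unfolding assms(6) by (simp add: ln_powr)
  have "ln (real (card A) * real (card B)) \<le> ln (2 ^ n * real (card B'))"
    using le posA posB posN by (subst ln_le_cancel_iff) auto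
  then have "ln (real (card A)) + ln (real (card B)) \<le> real n * ln 2 + ln (real (card B'))"
    using posA posB posN by (simp add: ln_mult ln_realpow)
  with lnA lnB have lnN: "ln (real (card B')) \<ge> (\<beta> - \<epsilon>) * real n * ln 2"
    by (simp add: algebra_simps)
  show ?thesis
  \<comment> \<open>The term \<open>3/2 * \<epsilon>\<close> is small against
    \<open>\<sigma>\<close> only for small \<open>\<sigma>\<close>; for large
    \<open>\<sigma>\<close> crude size bounds suffice.\<close>
  proof (cases "\<sigma> < 1/10")
    case True
    \<comment> \<open>Of order \<open>\<sigma>\<close> to balance
      \<open>\<epsilon> / (2 * \<rho>)\<close> against \<open>\<rho> / 4\<close>. The shift keeps
      \<open>\<rho>\<close> positive at \<open>\<epsilon> = 0\<close> and costs
      \<open>1/800\<close>, less than \<open>0.4228 - 37/88\<close>.\<close>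
    define \<rho> where "\<rho> = \<sigma> + 1/200"
    have \<rho>: "\<rho> > 0" using \<sigma> by (simp add: \<rho>_def)
    define c d x y where "c = 3 / (2 * sqrt 7 :: real)" and "d = sqrt (2 :: real)"
      and "x = (ln 7)\<^sup>2 / (8 :: real)" and "y = (ln 2)\<^sup>2 / (8 :: real)"
    define a where "a = real (card A) / 2 ^ n"
    have cd: "c > 0" "d > 0" "a > 0" using posA by (auto simp: c_def d_def a_def)
    let ?W = "(c * exp (- \<rho> * x)) ^ k * (d * exp (- \<rho> * y)) ^ (n - k) * (real (card B'))\<^sup>2 * a powr (1 + 1 / \<rho>)"
    have "?W \<le> (9/7) ^ k * 2 ^ (n - k)"
      using udcp_weighted_bound[OF assms(4) ts(2,1,4) \<rho>] by (simp add: c_def d_def x_def y_def a_def k_def)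
    moreover have "?W > 0"
      using cd posN by (intro mult_pos_pos zero_less_power) auto
    ultimately have "ln ?W \<le> ln ((9/7) ^ k * 2 ^ (n - k))" by simp
    then have "real k * (ln c - \<rho> * x) + (real n - real k) * (ln d - \<rho> * y) + 2 * ln (real (card B'))
        + (1 + 1 / \<rho>) * ln a \<le> real k * ln (9/7) + (real n - real k) * ln 2"
      using cd posN k by (simp add: ln_mult ln_realpow ln_powr of_nat_diff)
    moreover have "ln a = ln (real (card A)) - real n * ln 2"
      using posA by (simp add: a_def ln_div ln_realpow)
    moreover have "ln d = ln 2 / 2" by (simp add: d_def ln_sqrt)
    \<comment> \<open>This identifies the cost \<open>ln (9/7) - ln c\<close> of a selected
      coordinate as \<open>ln (36/7) / 2\<close>.\<close>
    moreover have "ln c = ln (9/7) - ln (36/7) / 2"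
    proof -
      have "2 * ln c = ln (c\<^sup>2)" using cd by (simp add: ln_realpow)
      also have "c\<^sup>2 = (9/7)\<^sup>2 / (36/7)" by (simp add: c_def power_divide power_mult_distrib)
      also have "ln \<dots> = 2 * ln (9/7) - ln (36/7)" by (subst ln_div) (simp_all add: ln_realpow)
      finally show ?thesis by simp
    qed
    ultimately have "2 * ln (real (card B')) + (1 + 1 / \<rho>) * (ln (real (card A)) - real n * ln 2)
      \<le> real k * (ln (36/7) / 2 + \<rho> * x) + (real n - real k) * (ln 2 / 2 + \<rho> * y)"
      by (simp add: algebra_simps diff_divide_distrib)
    moreover have "ln (real (card A)) - real n * ln 2 \<ge> - (\<epsilon> * real n * ln 2)"
      using lnA by (simp add: algebra_simps)
    ultimately have "\<beta> \<le> 37/88 + 3/2 * \<epsilon> + \<epsilon> / (2 * \<rho>) + \<rho> / 4"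
      using rate_le_of_log_inequality[OF assms(1) k \<rho> assms(2) _ lnN ln_constants(1,2)] ln_constants(3,4)
      unfolding x_def y_def by blast
    moreover have "\<epsilon> / (2 * \<rho>) \<le> \<sigma> / 2"
      using \<sigma> \<rho> by (simp add: \<rho>_def field_simps power2_eq_square)
    moreover have "\<epsilon> \<le> \<sigma> / 10"
      using \<sigma> True mult_left_mono[of \<sigma> "1/10" \<sigma>] by (simp add: power2_eq_square)
    \<comment> \<open>The coefficients of \<open>\<sigma>\<close> add up to
      \<open>3/20 + 1/2 + 1/4 = 9/10\<close>, and \<open>1057/2500\<close> is
      \<open>0.4228\<close>.\<close>
    ultimately have "\<beta> \<le> 1057/2500 + \<sigma>"
      using \<sigma>(1) \<rho>_def by linarith
    then show ?thesis by (simp add: \<sigma>_def)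
  next
    case False
    have "real (card B) \<le> real (2 ^ n)"
      using card_udcp_le[OF assms(4)] by (simp only: of_nat_le_iff)
    then have "ln (real (card B)) \<le> ln (2 ^ n)"
      using posB by (subst ln_le_cancel_iff) auto
    then have "\<beta> * (real n * ln 2) \<le> 1 * (real n * ln 2)"
      by (simp add: lnB ln_realpow)
    then have \<beta>1: "\<beta> \<le> 1" using n by (subst (asm) mult_le_cancel_right_pos) auto
    have "B' \<subseteq> binvecs (length ts)" using ts assms(4) by (auto simp: udcp_def)
    from card_le_if_inj_select[OF this ts(4)] have "real (card B') \<le> real (2 ^ k)"
      unfolding k_def by (simp only: of_nat_le_iff)
    then have "ln (real (card B')) \<le> ln (2 ^ k)"
      using posN by (subst ln_le_cancel_iff) auto
    also have "\<dots> = real k * ln 2" by (simp add: ln_realpow)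
    also have "\<dots> \<le> real n / 2 * ln 2" using k by (intro mult_right_mono) auto
    finally have "(\<beta> - \<epsilon>) * (real n * ln 2) \<le> 1/2 * (real n * ln 2)" using lnN by simp
    then have "\<beta> - \<epsilon> \<le> 1/2" using n by (subst (asm) mult_le_cancel_right_pos) auto
    \<comment> \<open>Up to \<open>\<sigma> = 9/10\<close> this turns
      \<open>1/2 + \<epsilon>\<close> into at most \<open>0.41 + \<sigma>\<close>; beyond it
      \<open>\<beta> \<le> 1\<close> is enough.\<close>
    moreover have "\<sigma>\<^sup>2 \<le> \<sigma> - 9/100" if "\<sigma> \<le> 9/10"
    proof -
      have "0 \<le> (\<sigma> - 1/10) * (9/10 - \<sigma>)"
        using False that by (intro mult_nonneg_nonneg) auto
      also have "\<dots> = \<sigma> - 9/100 - \<sigma>\<^sup>2"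
        by (simp add: power2_eq_square field_simps)
      finally show ?thesis by simp
    qed
    ultimately have "\<beta> \<le> 1057/2500 + \<sigma>"
      using \<beta>1 \<sigma>(2) by (cases "\<sigma> \<le> 9/10") auto
    then show ?thesis by (simp add: \<sigma>_def)
  qed
qed

end
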